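(* Let $\mathbf{B}=\{z=(z_j)_{j\ge1}\in\mathbb{D}^\infty: z_j\to0\}$ be the open unit ball of $c_0$, and let $\phi=(\phi_j)_{j\ge1}:\mathbf{B}\to\mathbf{B}$ be an analytic map such that $C_\phi f=f\circ\phi$ maps $A^+(\mathbb{T}^\infty)$ into itself. Then: (a) If $\phi(z)=(\epsilon_jz_{\sigma(j)})_{j\ge1}$ for some permutation $\sigma$ of $\mathbb{N}$ and some sequence $(\epsilon_j)_{j\ge1}$ of complex numbers of modulus $1$, then $C_\phi$ is an automorphism of $A^+(\mathbb{T}^\infty)$, and it is isometric. (b) If $C_\phi$ is an automorphism of $A^+(\mathbb{T}^\infty)$ and moreover, for each $k\in\mathbb{N}$, $\phi_k(z)=z_k^{d_k}u_k(z)$ for all $z\in\mathbf{B}$, with an integer $d_k\ge1$ and an analytic function $u_k$ on $\mathbf{B}$ with $u_k(0)\ne0$, then $\phi(z)=(\epsilon_jz_j)_{j\ge1}$ for some sequence $(\epsilon_j)_{j\ge1}$ of complex numbers of modulus $1$.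
   Context: $A^+(\mathbb{T}^\infty)$ is the algebra of functions $f(z)=\sum_{\alpha}a_\alpha z^\alpha$ on $\overline{\mathbb{D}}^\infty$, where $\alpha$ ranges over finitely supported sequences $(\alpha_1,\dots,\alpha_r,0,0,\dots)$ of non-negative integers, $z^\alpha=z_1^{\alpha_1}\cdots z_r^{\alpha_r}$, and $\|f\|_{A^+(\mathbb{T}^\infty)}=\sum_\alpha|a_\alpha|<\infty$; it is a commutative unital Banach algebra under pointwise multiplication. $\mathbf{B}$ carries the sup norm of $c_0$, and analyticity is in the sense of holomorphic maps on this Banach space. An automorphism is a bijective algebra homomorphism onto $A^+(\mathbb{T}^\infty)$. *)

theory Defs
  imports "HOL-Analysis.Analysis"
begin

text \<open>Points of the infinite polydisc are sequences indexed by nat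
  (index 0 here corresponds to the paper's index 1).\<close>

type_synonym seq = "nat \<Rightarrow> complex"

definition supnorm :: "seq \<Rightarrow> real" where
  "supnorm h = (SUP j. norm (h j))"

definition c0 :: "seq set" where
  "c0 = {h. (h \<longlonglongrightarrow> 0)}"

definition ballB :: "seq set" where
  "ballB = {z. (\<forall>j. norm (z j) < 1) \<and> (z \<longlonglongrightarrow> 0)}"

definition bounded_clinear_c0 :: "(seq \<Rightarrow> seq) \<Rightarrow> bool" where
  "bounded_clinear_c0 L \<longleftrightarrow>
     (\<forall>h\<in>c0. L h \<in> c0) \<and>
     (\<forall>a b h k. h \<in> c0 \<longrightarrow> k \<in> c0 \<longrightarrow>
         L (\<lambda>j. a * h j + b * k j) = (\<lambda>j. a * L h j + b * L k j)) \<and>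
     (\<exists>C. \<forall>h\<in>c0. supnorm (L h) \<le> C * supnorm h)"

definition bounded_clinear_functional_c0 :: "(seq \<Rightarrow> complex) \<Rightarrow> bool" where
  "bounded_clinear_functional_c0 L \<longleftrightarrow>
     (\<forall>a b h k. h \<in> c0 \<longrightarrow> k \<in> c0 \<longrightarrow>
         L (\<lambda>j. a * h j + b * k j) = a * L h + b * L k) \<and>
     (\<exists>C. \<forall>h\<in>c0. norm (L h) \<le> C * supnorm h)"

definition analytic_map_B :: "(seq \<Rightarrow> seq) \<Rightarrow> bool" where
  "analytic_map_B \<phi> \<longleftrightarrow>
     (\<forall>z\<in>ballB. \<phi> z \<in> c0) \<and>
     (\<forall>z\<in>ballB. \<exists>L. bounded_clinear_c0 L \<and>
        (\<forall>e>0. \<exists>d>0. \<forall>h\<in>c0. supnorm h < d \<longrightarrow>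
           supnorm (\<lambda>j. \<phi> (\<lambda>i. z i + h i) j - \<phi> z j - L h j) \<le> e * supnorm h))"

definition analytic_fun_B :: "(seq \<Rightarrow> complex) \<Rightarrow> bool" where
  "analytic_fun_B u \<longleftrightarrow>
     (\<forall>z\<in>ballB. \<exists>L. bounded_clinear_functional_c0 L \<and>
        (\<forall>e>0. \<exists>d>0. \<forall>h\<in>c0. supnorm h < d \<longrightarrow>
           norm (u (\<lambda>i. z i + h i) - u z - L h) \<le> e * supnorm h))"

definition MI :: "(nat \<Rightarrow> nat) set" where
  "MI = {\<alpha>. finite {j. \<alpha> j \<noteq> 0}}"

definition monom :: "seq \<Rightarrow> (nat \<Rightarrow> nat) \<Rightarrow> complex" where
  "monom z \<alpha> = (\<Prod>j\<in>{j. \<alpha> j \<noteq> 0}. z j ^ \<alpha> j)"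

text \<open>Elements of A^+(T^\<infinity>), represented by their restriction to B
  (set to 0 outside B, so that equality of elements is equality of functions).\<close>
definition Aplus_rep :: "((nat \<Rightarrow> nat) \<Rightarrow> complex) \<Rightarrow> (seq \<Rightarrow> complex) \<Rightarrow> bool" where
  "Aplus_rep a f \<longleftrightarrow>
     (\<forall>\<alpha>. \<alpha> \<notin> MI \<longrightarrow> a \<alpha> = 0) \<and>
     (\<lambda>\<alpha>. norm (a \<alpha>)) summable_on MI \<and>
     (\<forall>z. f z = (if z \<in> ballB then (\<Sum>\<^sub>\<infinity>\<alpha>\<in>MI. a \<alpha> * monom z \<alpha>) else 0))"

definition Aplus :: "(seq \<Rightarrow> complex) set" where
  "Aplus = {f. \<exists>a. Aplus_rep a f}"

definition Aplus_norm :: "(seq \<Rightarrow> complex) \<Rightarrow> real" where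
  "Aplus_norm f = (\<Sum>\<^sub>\<infinity>\<alpha>\<in>MI. norm ((SOME a. Aplus_rep a f) \<alpha>))"

definition Aplus_one :: "seq \<Rightarrow> complex" where
  "Aplus_one = (\<lambda>z. if z \<in> ballB then 1 else 0)"

definition comp_op :: "(seq \<Rightarrow> seq) \<Rightarrow> (seq \<Rightarrow> complex) \<Rightarrow> (seq \<Rightarrow> complex)" where
  "comp_op \<phi> f = (\<lambda>z. if z \<in> ballB then f (\<phi> z) else 0)"

definition Aplus_automorphism :: "((seq \<Rightarrow> complex) \<Rightarrow> (seq \<Rightarrow> complex)) \<Rightarrow> bool" where
  "Aplus_automorphism T \<longleftrightarrow>
     bij_betw T Aplus Aplus \<and>
     (\<forall>f\<in>Aplus. \<forall>g\<in>Aplus. T (\<lambda>z. f z + g z) = (\<lambda>z. T f z + T g z)) \<and>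
     (\<forall>f\<in>Aplus. \<forall>g\<in>Aplus. T (\<lambda>z. f z * g z) = (\<lambda>z. T f z * T g z)) \<and>
     (\<forall>c. \<forall>f\<in>Aplus. T (\<lambda>z. c * f z) = (\<lambda>z. c * T f z)) \<and>
     T Aplus_one = Aplus_one"

end

theory Submission
  imports Defs "HOL-Complex_Analysis.Conformal_Mappings"
begin

text \<open>For (a), a weighted permutation of the coordinates permutes the monomials up to unimodular
  factors, so everything reduces to the uniqueness of the coefficients.

  For (b), restrict to the \<open>k\<close>-th axis, which \<open>\<phi>\<close> maps into itself by some \<open>p\<close> with \<open>p(0) = 0\<close>.
  Surjectivity of \<open>C\<^sub>\<phi>\<close> gives an \<open>f\<close> with \<open>f \<circ> \<phi> = z\<^sub>k\<close>, whose restriction \<open>h\<close> to the axis satisfies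
  \<open>h \<circ> p = id\<close>; comparing spectra shows \<open>|h| \<le> 1\<close>. By the Schwarz lemma
  \<open>|t| = |h(p(t))| \<le> |p(t)| \<le> |t|\<^sup>d |u\<^sub>k| \<le> |t|\<^sup>d\<close>, so \<open>d = 1\<close> and \<open>|u\<^sub>k| = 1\<close> on the axis. As \<open>|u\<^sub>k| \<le> 1\<close>
  on the whole ball, the maximum principle makes \<open>u\<^sub>k\<close> constant.\<close>

hide_const (open) Polynomial.monom

section \<open>Uniqueness of coefficients\<close>

lemma monom_bound:
  assumes "z \<in> ballB"
  shows "norm (monom z \<alpha>) \<le> 1"
proof -
  have "norm (z j) \<le> 1" for j
    using assms by (auto simp: ballB_def intro: less_imp_le)
  then show ?thesis
    unfolding monom_def prod_norm [symmetric] norm_power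
    by (intro prod_le_1) (auto intro: power_le_one)
qed

lemma abs_summable_coeff_monom:
  assumes "(\<lambda>\<alpha>. norm (a \<alpha>)) summable_on MI" and "z \<in> ballB"
  shows "(\<lambda>\<alpha>. norm (a \<alpha> * monom z \<alpha>)) summable_on MI"
  by (rule Infinite_Sum.abs_summable_on_comparison_test [OF assms(1)])
     (use monom_bound [OF assms(2)] in \<open>auto simp: norm_mult intro: mult_left_le\<close>)

definition nth_prime :: "nat \<Rightarrow> nat" where
  "nth_prime = enumerate {p. prime p}"

text \<open>A Goedel numbering: by unique factorisation it turns multi-indices in \<open>MI\<close>
  into distinct positive integers, which supply both a well-order and the frequencies of a Dirichlet
  series. Outside \<open>MI\<close> the product runs over an infinite set and is 1 by
  convention.\<close>

definition prime_code :: "(nat \<Rightarrow> nat) \<Rightarrow> nat" where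
  "prime_code \<alpha> = (\<Prod>j\<in>{j. \<alpha> j \<noteq> 0}. nth_prime j ^ \<alpha> j)"

lemma prime_nth_prime: "prime (nth_prime j)"
  using enumerate_in_set [OF primes_infinite] by (auto simp: nth_prime_def)

lemma strict_mono_nth_prime: "strict_mono nth_prime"
  unfolding nth_prime_def using primes_infinite by (rule strict_mono_enumerate)

lemma multiplicity_prime_code:
  assumes "\<alpha> \<in> MI"
  shows "multiplicity (nth_prime j) (prime_code \<alpha>) = \<alpha> j"
proof -
  have inj: "inj nth_prime"
    using strict_mono_nth_prime by (rule strict_mono_imp_inj_on)
  let ?S = "{j. \<alpha> j \<noteq> 0}"
  \<comment> \<open>The product is reindexed by the primes themselves, so that the exponent of a
    given prime can be read off.\<close>
  have "prime_code \<alpha> = (\<Prod>q\<in>nth_prime ` ?S. q ^ \<alpha> (the_inv nth_prime q))"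
    unfolding prime_code_def
    by (subst prod.reindex) (use inj in \<open>auto simp: the_inv_f_f inj_on_def\<close>)
  also have "multiplicity (nth_prime j) \<dots> =
      (if nth_prime j \<in> nth_prime ` ?S then \<alpha> (the_inv nth_prime (nth_prime j)) else 0)"
    using assms by (intro multiplicity_prod_prime_powers) (auto simp: MI_def prime_nth_prime)
  also have "\<dots> = \<alpha> j"
    using inj by (simp add: the_inv_f_f inj_image_mem_iff)
  finally show ?thesis .
qed

lemma inj_on_prime_code: "inj_on prime_code MI"
proof (intro inj_onI ext)
  fix \<alpha> \<beta> j assume "\<alpha> \<in> MI" "\<beta> \<in> MI" "prime_code \<alpha> = prime_code \<beta>"
  then show "\<alpha> j = \<beta> j"
    using multiplicity_prime_code [of \<alpha> j] multiplicity_prime_code [of \<beta> j] by simp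
qed

lemma prime_code_pos: "prime_code \<alpha> > 0"
  unfolding prime_code_def using prime_nth_prime prime_gt_0_nat by (intro prod_pos) auto

text \<open>Substituting \<open>z\<^sub>j = p\<^sub>j\<^sup>-\<^sup>m\<close>, with \<open>p\<^sub>j\<close> the \<open>j\<close>-th prime, turns the series into the
  Dirichlet series \<open>\<Sum> a\<^sub>\<alpha> N(\<alpha>)\<^sup>-\<^sup>m\<close>, where \<open>N\<close> is injective by unique factorisation;
  letting \<open>m \<rightarrow> \<infinity>\<close> isolates the coefficient with the least \<open>N(\<alpha>)\<close>.\<close>

lemma coeff_eq_0:
  assumes sm: "(\<lambda>\<alpha>. norm (a \<alpha>)) summable_on MI"
    and zero: "\<And>z. z \<in> ballB \<Longrightarrow> (\<Sum>\<^sub>\<infinity>\<alpha>\<in>MI. a \<alpha> * monom z \<alpha>) = 0"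
    and "\<beta> \<in> MI"
  shows "a \<beta> = 0"
proof (rule ccontr)
  assume "a \<beta> \<noteq> 0"
  then obtain \<alpha>0 where \<alpha>0: "\<alpha>0 \<in> MI" "a \<alpha>0 \<noteq> 0"
    and least: "\<And>\<alpha>. \<alpha> \<in> MI \<Longrightarrow> a \<alpha> \<noteq> 0 \<Longrightarrow> prime_code \<alpha>0 \<le> prime_code \<alpha>"
    using ex_has_least_nat [of "\<lambda>\<alpha>. \<alpha> \<in> MI \<and> a \<alpha> \<noteq> 0" \<beta> prime_code] \<open>\<beta> \<in> MI\<close> by blast
  define n where "n = prime_code \<alpha>0"
  \<comment> \<open>Every other index with a nonzero coefficient has code at least n + 1, so
    \<open>q\<close> bounds all the ratios n / N(\<alpha>) at once.\<close>
  define q where "q = real n / real (n + 1)"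
  define C where "C = (\<Sum>\<^sub>\<infinity>\<alpha>\<in>MI. norm (a \<alpha>))"
  have n: "n > 0"
    by (simp add: n_def prime_code_pos)
  have q: "0 \<le> q" "q < 1"
    using n by (auto simp: q_def)
  \<comment> \<open>The case m = 0 is excluded: it would give the constant sequence 1, which lies
    outside the ball.\<close>
  have bound: "norm (a \<alpha>0) \<le> q ^ m * C" if m: "m > 0" for m
  proof -
    define z :: seq where "z = (\<lambda>j. 1 / of_nat (nth_prime j) ^ m)"
    \<comment> \<open>The series at \<open>z\<close>, scaled by n^m: the term at
      \<open>\<alpha>0\<close> becomes \<open>a \<alpha>0\<close> for every m, and the remaining
      terms decay like q^m.\<close>
    define r where "r = (\<lambda>\<alpha>. a \<alpha> * (of_nat n / of_nat (prime_code \<alpha>)) ^ m)"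
    have "norm (z j) < 1" for j
    proof -
      have "real (nth_prime j) > 1"
        using prime_gt_1_nat [OF prime_nth_prime] by simp
      then show ?thesis
        using m by (simp add: z_def norm_divide norm_power)
    qed
    moreover have "z \<longlonglongrightarrow> 0"
    proof (rule Lim_null_comparison)
      show "(\<lambda>j. inverse (real (Suc j))) \<longlonglongrightarrow> 0"
        by (rule LIMSEQ_inverse_real_of_nat)
      show "\<forall>\<^sub>F j in sequentially. norm (z j) \<le> inverse (real (Suc j))"
      proof (rule always_eventually, rule allI)
        fix j
        have "Suc j \<le> nth_prime j"
          using prime_gt_1_nat [OF prime_nth_prime, of 0] strict_mono_imp_increasing [OF strict_mono_nth_prime]
          by (induction j) (auto simp: Suc_le_eq intro: le_less_trans strict_monoD [OF strict_mono_nth_prime])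
        then have "real (Suc j) \<le> real (nth_prime j)"
          by linarith
        also have "\<dots> \<le> real (nth_prime j) ^ m"
          using m prime_ge_1_nat [OF prime_nth_prime, of j] by (intro self_le_power) auto
        finally show "norm (z j) \<le> inverse (real (Suc j))"
          by (simp add: z_def norm_divide norm_power divide_simps)
      qed
    qed
    ultimately have zB: "z \<in> ballB"
      by (simp add: ballB_def)
    have r_eq: "r \<alpha> = of_nat n ^ m * (a \<alpha> * monom z \<alpha>)" for \<alpha>
    proof -
      have "monom z \<alpha> = 1 / of_nat (prime_code \<alpha>) ^ m"
        by (simp add: monom_def z_def prime_code_def power_one_over prod_dividef
            prod_power_distrib flip: power_mult power_divide)
           (simp add: mult.commute)
      then show ?thesis
        by (simp add: r_def power_divide)
    qed
    have nr: "(\<lambda>\<alpha>. norm (r \<alpha>)) summable_on MI"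
      unfolding r_eq norm_mult [of "of_nat n ^ m"]
      by (intro summable_on_cmult_right abs_summable_coeff_monom sm zB)
    then have rs: "r summable_on MI"
      by (rule abs_summable_summable)
    have "infsum r MI = 0"
      unfolding r_eq using zero [OF zB] by (simp add: infsum_cmult_right')
    moreover have "infsum r (MI - {\<alpha>0}) = infsum r MI - infsum r {\<alpha>0}"
      by (rule infsum_Diff) (use rs \<alpha>0 in auto)
    moreover have "r \<alpha>0 = a \<alpha>0"
      using n by (simp add: r_def n_def)
    ultimately have "norm (a \<alpha>0) = norm (infsum r (MI - {\<alpha>0}))"
      by simp
    also have "\<dots> \<le> (\<Sum>\<^sub>\<infinity>\<alpha>\<in>MI - {\<alpha>0}. norm (r \<alpha>))"
      by (rule norm_infsum_bound) (rule summable_on_subset_banach [OF nr], auto)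
    also have "\<dots> \<le> (\<Sum>\<^sub>\<infinity>\<alpha>\<in>MI. q ^ m * norm (a \<alpha>))"
    proof (rule infsum_mono_neutral)
      show "(\<lambda>\<alpha>. norm (r \<alpha>)) summable_on MI - {\<alpha>0}"
        by (rule summable_on_subset_banach [OF nr]) auto
      show "(\<lambda>\<alpha>. q ^ m * norm (a \<alpha>)) summable_on MI"
        by (intro summable_on_cmult_right sm)
      fix \<alpha> assume \<alpha>: "\<alpha> \<in> (MI - {\<alpha>0}) \<inter> MI"
      show "norm (r \<alpha>) \<le> q ^ m * norm (a \<alpha>)"
      proof (cases "a \<alpha> = 0")
        case False
        then have "n + 1 \<le> prime_code \<alpha>"
          using \<alpha> \<alpha>0 least [of \<alpha>] inj_on_prime_code
          by (auto simp: n_def Suc_le_eq order.strict_iff_order dest: inj_onD)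
        then have "real n / real (prime_code \<alpha>) \<le> q"
          unfolding q_def by (intro divide_left_mono) auto
        then have "(real n / real (prime_code \<alpha>)) ^ m \<le> q ^ m"
          by (intro power_mono) auto
        then show ?thesis
          by (simp add: r_def norm_mult norm_power norm_divide mult.commute [of "norm (a \<alpha>)"] mult_right_mono)
      qed (simp add: r_def)
    qed (use q in auto)
    also have "\<dots> = q ^ m * C"
      by (simp add: C_def infsum_cmult_right')
    finally show ?thesis .
  qed
  have "(\<lambda>m. q ^ m * C) \<longlonglongrightarrow> 0 * C"
    using q by (intro tendsto_intros) auto
  then have "norm (a \<alpha>0) \<le> 0 * C"
    by (rule Lim_bounded2 [where N = 1]) (use bound in auto)
  with \<alpha>0 show False
    by simp
qed

lemma Aplus_rep_unique:
  assumes a: "Aplus_rep a f" and b: "Aplus_rep b f"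
  shows "a = b"
proof
  fix \<alpha>
  have sa: "(\<lambda>\<alpha>. norm (a \<alpha>)) summable_on MI" and sb: "(\<lambda>\<alpha>. norm (b \<alpha>)) summable_on MI"
    using a b by (auto simp: Aplus_rep_def)
  show "a \<alpha> = b \<alpha>"
  proof (cases "\<alpha> \<in> MI")
    case True
    have "a \<alpha> - b \<alpha> = 0"
    proof (rule coeff_eq_0 [OF _ _ True])
      show "(\<lambda>\<alpha>. norm (a \<alpha> - b \<alpha>)) summable_on MI"
        by (rule Infinite_Sum.abs_summable_on_comparison_test' [OF summable_on_add [OF sa sb]])
           (rule norm_triangle_ineq4)
      fix z assume z: "z \<in> ballB"
      have "(\<Sum>\<^sub>\<infinity>\<alpha>\<in>MI. (a \<alpha> - b \<alpha>) * monom z \<alpha>) =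
            (\<Sum>\<^sub>\<infinity>\<alpha>\<in>MI. a \<alpha> * monom z \<alpha>) - (\<Sum>\<^sub>\<infinity>\<alpha>\<in>MI. b \<alpha> * monom z \<alpha>)"
        using infsum_add [OF abs_summable_summable [OF abs_summable_coeff_monom [OF sa z]]
            summable_on_uminus [THEN iffD2, OF abs_summable_summable [OF abs_summable_coeff_monom [OF sb z]]]]
        by (simp add: infsum_uminus left_diff_distrib)
      then show "(\<Sum>\<^sub>\<infinity>\<alpha>\<in>MI. (a \<alpha> - b \<alpha>) * monom z \<alpha>) = 0"
        using z a [unfolded Aplus_rep_def, THEN conjunct2, THEN conjunct2, rule_format, of z]
          b [unfolded Aplus_rep_def, THEN conjunct2, THEN conjunct2, rule_format, of z]
        by simp
    qed
    then show ?thesis by simp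
  qed (use a b in \<open>auto simp: Aplus_rep_def\<close>)
qed

text \<open>Uniqueness makes the choice by \<open>SOME\<close> in the norm harmless: any
  representation may be used to compute it.\<close>

lemma Aplus_norm_eq:
  assumes "Aplus_rep a f"
  shows "Aplus_norm f = (\<Sum>\<^sub>\<infinity>\<alpha>\<in>MI. norm (a \<alpha>))"
  unfolding Aplus_norm_def Aplus_rep_unique [OF someI [of "\<lambda>a. Aplus_rep a f", OF assms] assms] ..

section \<open>Weighted permutations of the coordinates\<close>

lemma weighted_perm_in_ballB:
  assumes \<sigma>: "bij \<sigma>" and \<epsilon>: "\<And>j. norm (\<epsilon> j) = 1" and z: "z \<in> ballB"
  shows "(\<lambda>j. \<epsilon> j * z (\<sigma> j)) \<in> ballB"
proof -
  \<comment> \<open>A permutation of the naturals tends to infinity because preimages of finite sets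
    under an injection are finite; hence permuted null sequences are null.\<close>
  have "filterlim \<sigma> sequentially sequentially"
    unfolding cofinite_eq_sequentially [symmetric] filterlim_iff eventually_cofinite
  proof (intro allI impI)
    fix P :: "nat \<Rightarrow> bool" assume "finite {x. \<not> P x}"
    then show "finite {x. \<not> P (\<sigma> x)}"
      using finite_vimageI [OF _ bij_is_inj [OF \<sigma>], of "{x. \<not> P x}"] by (simp add: vimage_def)
  qed
  then have "(\<lambda>j. z (\<sigma> j)) \<longlonglongrightarrow> 0"
    using z by (auto simp: ballB_def intro: filterlim_compose)
  then have "(\<lambda>j. norm (\<epsilon> j * z (\<sigma> j))) \<longlonglongrightarrow> 0"
    by (simp add: norm_mult \<epsilon> tendsto_norm_zero)
  then have "(\<lambda>j. \<epsilon> j * z (\<sigma> j)) \<longlonglongrightarrow> 0"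
    by (rule tendsto_norm_zero_cancel)
  then show ?thesis
    using z \<epsilon> by (auto simp: ballB_def norm_mult)
qed

lemma MI_comp_bij:
  assumes "bij \<sigma>"
  shows "bij_betw (\<lambda>\<alpha>. \<alpha> \<circ> \<sigma>) MI MI"
proof -
  have *: "\<alpha> \<circ> \<tau> \<in> MI" if "\<alpha> \<in> MI" "bij \<tau>" for \<alpha> and \<tau> :: "nat \<Rightarrow> nat"
    using that finite_vimageI [of "{j. \<alpha> j \<noteq> 0}" \<tau>] by (auto simp: MI_def vimage_def bij_def)
  show ?thesis
    by (rule bij_betw_byWitness [where f' = "\<lambda>\<alpha>. \<alpha> \<circ> inv \<sigma>"])
       (use assms * [OF _ bij_imp_bij_inv [OF assms]] in \<open>auto simp: * o_assoc [symmetric] bij_def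
          surj_iff [THEN iffD1] inj_iff [THEN iffD1]\<close>)
qed

text \<open>Substitution sends the monomial of index \<beta> o \<sigma> to that of index \<beta>;
  the weights collect into one factor, which is itself a monomial evaluated at \<epsilon>.\<close>

lemma monom_weighted_perm:
  assumes "bij \<sigma>"
  shows "monom (\<lambda>j. \<epsilon> j * z (\<sigma> j)) (\<beta> \<circ> \<sigma>) = monom \<epsilon> (\<beta> \<circ> \<sigma>) * monom z \<beta>"
proof -
  have "bij_betw \<sigma> {j. (\<beta> \<circ> \<sigma>) j \<noteq> 0} {j. \<beta> j \<noteq> 0}"
    using assms
    by (intro bij_betwI [where g = "inv \<sigma>"]) (auto simp: bij_is_inj bij_is_surj surj_f_inv_f)
  then have "(\<Prod>j\<in>{j. (\<beta> \<circ> \<sigma>) j \<noteq> 0}. z (\<sigma> j) ^ \<beta> (\<sigma> j)) = monom z \<beta>"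
    unfolding monom_def by (rule prod.reindex_bij_betw)
  then show ?thesis
    by (simp add: monom_def power_mult_distrib prod.distrib)
qed

text \<open>The coefficients are permuted and multiplied by unimodular numbers, so the sum of their
  moduli is preserved. Prescribing \<psi> on the ball suffices, since \<open>comp_op\<close>
  evaluates it only there.\<close>

lemma Aplus_rep_weighted_perm:
  assumes \<sigma>: "bij \<sigma>" and \<epsilon>: "\<And>j. norm (\<epsilon> j) = 1"
    and \<psi>: "\<And>z. z \<in> ballB \<Longrightarrow> \<psi> z = (\<lambda>j. \<epsilon> j * z (\<sigma> j))"
    and a: "Aplus_rep a f"
  shows "Aplus_rep (\<lambda>\<beta>. a (\<beta> \<circ> \<sigma>) * monom \<epsilon> (\<beta> \<circ> \<sigma>)) (comp_op \<psi> f)"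
    and "Aplus_norm (comp_op \<psi> f) = Aplus_norm f"
proof -
  note bij = MI_comp_bij [OF \<sigma>]
  have norm_monom: "norm (monom \<epsilon> \<alpha>) = 1" for \<alpha>
    unfolding monom_def prod_norm [symmetric] norm_power by (simp add: \<epsilon>)
  let ?b = "\<lambda>\<beta>. a (\<beta> \<circ> \<sigma>) * monom \<epsilon> (\<beta> \<circ> \<sigma>)"
  have nb: "norm (?b \<beta>) = norm (a (\<beta> \<circ> \<sigma>))" for \<beta>
    by (simp add: norm_mult norm_monom)
  show rep: "Aplus_rep ?b (comp_op \<psi> f)"
    unfolding Aplus_rep_def
  proof (intro conjI allI impI)
    fix \<beta> assume "\<beta> \<notin> MI"
    moreover have "(\<beta> \<circ> \<sigma>) \<circ> inv \<sigma> = \<beta>"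
      using \<sigma> by (simp add: o_assoc [symmetric] bij_def surj_iff [THEN iffD1])
    ultimately have "\<beta> \<circ> \<sigma> \<notin> MI"
      using MI_comp_bij [OF bij_imp_bij_inv [OF \<sigma>]] by (metis bij_betwE)
    then show "?b \<beta> = 0"
      using a by (simp add: Aplus_rep_def)
  next
    show "(\<lambda>\<beta>. norm (?b \<beta>)) summable_on MI"
      unfolding nb using a summable_on_reindex_bij_betw [OF bij, of "\<lambda>\<alpha>. norm (a \<alpha>)"]
      by (simp add: Aplus_rep_def)
  next
    fix z
    show "comp_op \<psi> f z = (if z \<in> ballB then \<Sum>\<^sub>\<infinity>\<beta>\<in>MI. ?b \<beta> * monom z \<beta> else 0)"
    proof (cases "z \<in> ballB")
      case True
      have "(\<Sum>\<^sub>\<infinity>\<beta>\<in>MI. ?b \<beta> * monom z \<beta>) =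
            (\<Sum>\<^sub>\<infinity>\<beta>\<in>MI. a (\<beta> \<circ> \<sigma>) * monom (\<lambda>j. \<epsilon> j * z (\<sigma> j)) (\<beta> \<circ> \<sigma>))"
        by (simp add: monom_weighted_perm [OF \<sigma>] mult.assoc)
      also have "\<dots> = (\<Sum>\<^sub>\<infinity>\<alpha>\<in>MI. a \<alpha> * monom (\<lambda>j. \<epsilon> j * z (\<sigma> j)) \<alpha>)"
        by (rule infsum_reindex_bij_betw [OF bij])
      also have "\<dots> = f (\<psi> z)"
        using a True weighted_perm_in_ballB [OF \<sigma> \<epsilon> True] by (simp add: Aplus_rep_def \<psi>)
      finally show ?thesis
        using True by (simp add: comp_op_def)
    qed (simp add: comp_op_def)
  qed
  show "Aplus_norm (comp_op \<psi> f) = Aplus_norm f"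
    unfolding Aplus_norm_eq [OF rep] Aplus_norm_eq [OF a] nb
    by (rule infsum_reindex_bij_betw [OF bij])
qed

lemma weighted_perm_automorphism:
  assumes \<sigma>: "bij \<sigma>" and \<epsilon>: "\<And>j. norm (\<epsilon> j) = 1"
    and \<phi>: "\<And>z. z \<in> ballB \<Longrightarrow> \<phi> z = (\<lambda>j. \<epsilon> j * z (\<sigma> j))"
  shows "Aplus_automorphism (comp_op \<phi>)"
proof -
  \<comment> \<open>The inverse map, found by solving w_j = \<epsilon>_j z_\<sigma>(j) for z; it is
    again a weighted permutation, so the preceding results apply to it.\<close>
  define \<psi> where "\<psi> = (\<lambda>(z::seq) j. inverse (\<epsilon> (inv \<sigma> j)) * z (inv \<sigma> j))"
  have \<epsilon>': "norm (inverse (\<epsilon> (inv \<sigma> j))) = 1" for j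
    by (simp add: norm_inverse \<epsilon>)
  have \<epsilon>0: "\<epsilon> j \<noteq> 0" for j
    using \<epsilon> [of j] by auto
  note \<sigma>' = bij_imp_bij_inv [OF \<sigma>]
  have \<phi>B: "\<phi> z \<in> ballB" and \<psi>B: "\<psi> z \<in> ballB" if "z \<in> ballB" for z
    using weighted_perm_in_ballB [OF \<sigma> \<epsilon> that] weighted_perm_in_ballB [OF \<sigma>' \<epsilon>' that]
    by (simp_all add: \<phi> \<psi>_def that)
  have \<psi>\<phi>: "\<psi> (\<phi> z) = z" and \<phi>\<psi>: "\<phi> (\<psi> z) = z" if "z \<in> ballB" for z
    using that \<psi>B \<epsilon>0 \<sigma> by (auto simp: \<phi> \<psi>_def bij_is_surj surj_f_inv_f bij_is_inj)
  \<comment> \<open>Off the ball both the elements of \<open>Aplus\<close> and the values of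
    \<open>comp_op\<close> are 0, so the two composition operators are mutually inverse as maps of
    total functions.\<close>
  have zero: "f z = 0" if "f \<in> Aplus" "z \<notin> ballB" for f z
    using that by (auto simp: Aplus_def Aplus_rep_def)
  have \<phi>A: "comp_op \<phi> f \<in> Aplus" and \<psi>A: "comp_op \<psi> f \<in> Aplus" if "f \<in> Aplus" for f
    using that Aplus_rep_weighted_perm(1) [OF \<sigma> \<epsilon> \<phi>]
      Aplus_rep_weighted_perm(1) [of "inv \<sigma>" "\<lambda>j. inverse (\<epsilon> (inv \<sigma> j))" \<psi>, OF \<sigma>' \<epsilon>']
    unfolding Aplus_def \<psi>_def by blast+
  have "bij_betw (comp_op \<phi>) Aplus Aplus"
    by (rule bij_betw_byWitness [where f' = "comp_op \<psi>"])
       (use \<phi>A \<psi>A in \<open>auto simp: comp_op_def fun_eq_iff zero \<phi>B \<psi>B \<psi>\<phi> \<phi>\<psi>\<close>)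
  then show ?thesis
    using \<phi>B by (auto simp: Aplus_automorphism_def comp_op_def Aplus_one_def fun_eq_iff)
qed

section \<open>Restrictions to coordinate axes\<close>

text \<open>Polymorphic because it serves twice: for the points t e_k of the axis and for the
  multi-indices n e_k of the powers of z_k.\<close>

definition on_axis :: "nat \<Rightarrow> 'a \<Rightarrow> nat \<Rightarrow> 'a::zero" where
  "on_axis k t = (\<lambda>j. if j = k then t else 0)"

lemma on_axis_same [simp]: "on_axis k t k = t"
  by (simp add: on_axis_def)

lemma on_axis_in_ballB:
  assumes "norm t < 1"
  shows "on_axis k t \<in> ballB"
proof -
  have "\<forall>\<^sub>F j in sequentially. on_axis k t j = 0"
    unfolding eventually_sequentially on_axis_def by (intro exI [of _ "Suc k"]) auto
  then show ?thesis
    using assms by (auto simp: ballB_def tendsto_eventually) (simp add: on_axis_def)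
qed

lemma on_axis_in_c0: "on_axis k t \<in> c0"
proof -
  have "\<forall>\<^sub>F j in sequentially. on_axis k t j = 0"
    unfolding eventually_sequentially on_axis_def by (intro exI [of _ "Suc k"]) auto
  then show ?thesis
    by (simp add: c0_def tendsto_eventually)
qed

lemma inj_on_axis: "inj (on_axis k)"
  by (rule injI) (metis on_axis_same)

lemma range_on_axis_subset_MI: "range (on_axis k) \<subseteq> MI"
  by (auto simp: MI_def on_axis_def)

lemma monom_on_axis_index: "monom z (on_axis k n) = z k ^ n"
  by (cases "n = 0") (auto simp: monom_def on_axis_def)

text \<open>Such an index has a positive exponent at some j other than k, where the point has
  coordinate 0. Finite support matters: an infinite product would be 1 by convention.\<close>

lemma monom_on_axis_eq_0:
  assumes "\<alpha> \<in> MI" "\<alpha> \<notin> range (on_axis k)"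
  shows "monom (on_axis k t) \<alpha> = 0"
proof -
  have "\<alpha> \<noteq> on_axis k (\<alpha> k)"
    using assms(2) by blast
  then obtain j where "j \<noteq> k" "\<alpha> j \<noteq> 0"
    by (auto simp: on_axis_def fun_eq_iff split: if_splits)
  then show ?thesis
    using assms(1) unfolding monom_def
    by (intro prod_zero) (auto simp: MI_def on_axis_def power_0_left)
qed

text \<open>On the axis only the powers of z_k survive, which leaves a one-variable power
  series.\<close>

lemma holomorphic_Aplus_on_axis:
  assumes "f \<in> Aplus"
  shows "(\<lambda>t. f (on_axis k t)) holomorphic_on ball 0 1"
proof -
  obtain a where a: "Aplus_rep a f"
    using assms by (auto simp: Aplus_def)
  have sm: "(\<lambda>\<alpha>. norm (a \<alpha>)) summable_on MI"
    using a by (simp add: Aplus_rep_def)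
  have "(\<lambda>n. a (on_axis k n) * (t - 0) ^ n) sums f (on_axis k t)" if t: "t \<in> ball 0 1" for t
  proof -
    note tB = on_axis_in_ballB [of t k]
    have "((\<lambda>\<alpha>. a \<alpha> * monom (on_axis k t) \<alpha>) has_sum f (on_axis k t)) MI"
      using a t tB abs_summable_summable [OF abs_summable_coeff_monom [OF sm tB]]
      by (simp add: Aplus_rep_def has_sum_infsum)
    also have "?this \<longleftrightarrow>
        ((\<lambda>\<alpha>. a \<alpha> * monom (on_axis k t) \<alpha>) has_sum f (on_axis k t)) (range (on_axis k))"
      using range_on_axis_subset_MI [of k]
      by (intro has_sum_cong_neutral) (auto simp: monom_on_axis_eq_0)
    also have "\<dots> \<longleftrightarrow> ((\<lambda>n. a (on_axis k n) * t ^ n) has_sum f (on_axis k t)) UNIV"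
      by (subst has_sum_reindex [OF inj_on_axis])
         (simp add: o_def monom_on_axis_index)
    finally show ?thesis
      by (simp add: has_sum_imp_sums)
  qed
  then show ?thesis
    by (rule power_series_holomorphic)
qed

text \<open>Supplies the elements to which surjectivity of the composition operator is applied
  later: z_k itself and the resolvent 1 / (z_k - l) with |l| > 1.\<close>

lemma coordinate_series_in_Aplus:
  assumes "summable (\<lambda>n. norm (b n))"
  shows "(\<lambda>z. if z \<in> ballB then \<Sum>n. b n * z k ^ n else 0) \<in> Aplus"
proof -
  define a where "a = (\<lambda>\<alpha>. if \<alpha> \<in> range (on_axis k) then b (\<alpha> k) else 0)"
  have a_axis: "a (on_axis k n) = b n" for n
    by (simp add: a_def)
  have "(\<lambda>\<alpha>. norm (a \<alpha>)) summable_on range (on_axis k)"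
    using assms by (subst summable_on_reindex [OF inj_on_axis])
      (simp add: o_def a_axis norm_summable_imp_summable_on)
  also have "?this \<longleftrightarrow> (\<lambda>\<alpha>. norm (a \<alpha>)) summable_on MI"
    using range_on_axis_subset_MI [of k] by (intro summable_on_cong_neutral) (auto simp: a_def)
  finally have sm: "(\<lambda>\<alpha>. norm (a \<alpha>)) summable_on MI" .
  have "(\<Sum>n. b n * z k ^ n) = (\<Sum>\<^sub>\<infinity>\<alpha>\<in>MI. a \<alpha> * monom z \<alpha>)" if z: "z \<in> ballB" for z
  proof -
    have "norm (z k) \<le> 1"
      using z by (simp add: ballB_def less_imp_le)
    then have "norm (norm (b n * z k ^ n)) \<le> norm (b n)" for n
      by (simp add: norm_mult norm_power mult_left_le power_le_one)
    then have "summable (\<lambda>n. norm (b n * z k ^ n))"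
      by (rule summable_comparison_test' [OF assms])
    then have "((\<lambda>n. b n * z k ^ n) has_sum (\<Sum>n. b n * z k ^ n)) UNIV"
      by (metis norm_summable_imp_has_sum summable_sums summable_norm_cancel)
    also have "?this \<longleftrightarrow>
        ((\<lambda>\<alpha>. a \<alpha> * monom z \<alpha>) has_sum (\<Sum>n. b n * z k ^ n)) (range (on_axis k))"
      by (subst has_sum_reindex [OF inj_on_axis]) (simp add: o_def monom_on_axis_index a_axis)
    also have "\<dots> \<longleftrightarrow> ((\<lambda>\<alpha>. a \<alpha> * monom z \<alpha>) has_sum (\<Sum>n. b n * z k ^ n)) MI"
      using range_on_axis_subset_MI [of k] by (intro has_sum_cong_neutral) (auto simp: a_def)
    finally show ?thesis
      by (simp add: infsumI)
  qed
  then have "Aplus_rep a (\<lambda>z. if z \<in> ballB then \<Sum>n. b n * z k ^ n else 0)"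
    using sm range_on_axis_subset_MI [of k] by (auto simp: Aplus_rep_def a_def)
  then show ?thesis
    by (auto simp: Aplus_def)
qed

section \<open>Analytic functions on the ball along complex lines\<close>

lemma norm_le_supnorm:
  assumes "y \<in> c0"
  shows "norm (y j) \<le> supnorm y"
proof -
  have "Bseq y"
    using assms by (auto simp: c0_def intro!: convergent_imp_Bseq convergentI)
  then have "bdd_above (range (\<lambda>j. norm (y j)))"
    by (auto simp: Bseq_def bdd_above_def)
  then show ?thesis
    unfolding supnorm_def by (intro cSUP_upper) auto
qed

lemma supnorm_scale_le:
  assumes "y \<in> c0"
  shows "supnorm (\<lambda>j. c * y j) \<le> norm c * supnorm y"
  using norm_le_supnorm [OF assms]
  unfolding supnorm_def [of "\<lambda>j. c * y j"] norm_mult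
  by (intro cSUP_least mult_left_mono) auto

text \<open>The chain rule for an affine map: the derivative at t is the Frechet derivative
  \<open>L\<close> applied to the direction y.\<close>

lemma holomorphic_analytic_fun_B_on_line:
  assumes u: "analytic_fun_B u" and y: "y \<in> c0" and S: "open S"
    and line: "\<And>t. t \<in> S \<Longrightarrow> (\<lambda>j. x j + t * y j) \<in> ballB"
  shows "(\<lambda>t. u (\<lambda>j. x j + t * y j)) holomorphic_on S"
proof -
  define M where "M = supnorm y"
  have M: "M \<ge> 0"
    using norm_le_supnorm [OF y, of 0] norm_ge_zero [of "y 0"] unfolding M_def by linarith
  have cy: "(\<lambda>j. c * y j) \<in> c0" for c
    using y unfolding c0_def mem_Collect_eq by (rule tendsto_mult_right_zero)
  have "\<exists>D. ((\<lambda>t. u (\<lambda>j. x j + t * y j)) has_field_derivative D) (at t)" if t: "t \<in> S" for t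
  proof -
    obtain L where L: "bounded_clinear_functional_c0 L"
      and diff: "\<And>e. e > 0 \<Longrightarrow> \<exists>d>0. \<forall>h\<in>c0. supnorm h < d \<longrightarrow>
        norm (u (\<lambda>i. (x i + t * y i) + h i) - u (\<lambda>i. x i + t * y i) - L h) \<le> e * supnorm h"
      using bspec [OF u [unfolded analytic_fun_B_def] line [OF t]] by auto
    have L_scale: "L (\<lambda>j. c * y j) = L y * c" for c
    proof -
      have "L (\<lambda>j. c * y j + 0 * y j) = c * L y + 0 * L y"
        using L y unfolding bounded_clinear_functional_c0_def by blast
      then show ?thesis
        by (simp add: mult.commute)
    qed
    have "((\<lambda>t. u (\<lambda>j. x j + t * y j)) has_field_derivative L y) (at t)"
      unfolding has_field_derivative_def has_derivative_at_alt
    proof (intro conjI allI impI bounded_linear_mult_right)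
      fix e :: real assume e: "e > 0"
      \<comment> \<open>The tolerance is divided by M + 1 rather than M, because the direction y may
        be zero.\<close>
      then obtain d where d: "d > 0" and bd: "\<And>h. h \<in> c0 \<Longrightarrow> supnorm h < d \<Longrightarrow>
          norm (u (\<lambda>i. (x i + t * y i) + h i) - u (\<lambda>i. x i + t * y i) - L h)
            \<le> e / (M + 1) * supnorm h"
        using diff [of "e / (M + 1)"] M by auto
      show "\<exists>d>0. \<forall>s. norm (s - t) < d \<longrightarrow>
          norm (u (\<lambda>j. x j + s * y j) - u (\<lambda>j. x j + t * y j) - L y * (s - t)) \<le> e * norm (s - t)"
      proof (intro exI [of _ "d / (M + 1)"] conjI allI impI)
        show "d / (M + 1) > 0"
          using d M by simp
        fix s assume s: "norm (s - t) < d / (M + 1)"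
        let ?h = "\<lambda>j. (s - t) * y j"
        have h: "supnorm ?h \<le> norm (s - t) * (M + 1)"
          using supnorm_scale_le [OF y, of "s - t"] unfolding M_def [symmetric]
          by (rule order_trans) (simp add: mult_left_mono)
        also have "\<dots> < d"
          using s M by (simp add: field_simps)
        finally have "norm (u (\<lambda>i. (x i + t * y i) + ?h i) - u (\<lambda>i. x i + t * y i) - L ?h)
            \<le> e / (M + 1) * supnorm ?h"
          by (intro bd cy)
        also have "\<dots> \<le> e / (M + 1) * (norm (s - t) * (M + 1))"
          using h e M by (intro mult_left_mono) auto
        also have "\<dots> = e * norm (s - t)"
          using M by (simp add: field_simps)
        finally show "norm (u (\<lambda>j. x j + s * y j) - u (\<lambda>j. x j + t * y j) - L y * (s - t))
            \<le> e * norm (s - t)"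
          unfolding L_scale by (simp add: algebra_simps)
      qed
    qed
    then show ?thesis ..
  qed
  then show ?thesis
    using S by (simp add: holomorphic_on_open)
qed

text \<open>Only finitely many coordinates reach modulus 1/2, and each of them is below 1. Hence t z
  stays in the ball for |t| < 1/r, a disc that contains t = 1.\<close>

lemma ballB_uniform_bound:
  assumes "z \<in> ballB"
  obtains r where "0 < r" "r < 1" "\<And>j. norm (z j) \<le> r"
proof -
  have "\<forall>\<^sub>F j in sequentially. norm (z j) < 1 / 2"
    using assms by (auto simp: ballB_def tendsto_iff dist_norm dest: spec [of _ "1/2"])
  then obtain N where N: "\<And>j. j \<ge> N \<Longrightarrow> norm (z j) < 1 / 2"
    by (auto simp: eventually_sequentially)
  define A where "A = insert (1 / 2) ((\<lambda>j. norm (z j)) ` {..<N})"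
  have A: "finite A" "A \<noteq> {}"
    by (auto simp: A_def)
  show ?thesis
  proof (rule that [of "Max A"])
    have "1 / 2 \<le> Max A"
      using A by (intro Max_ge) (auto simp: A_def)
    then show "0 < Max A"
      by linarith
    show "Max A < 1"
      using assms A by (subst Max_less_iff) (auto simp: A_def ballB_def)
    fix j
    show "norm (z j) \<le> Max A"
    proof (cases "j < N")
      case True
      then show ?thesis
        using A by (intro Max_ge) (auto simp: A_def)
    next
      case False
      then show ?thesis
        using N [of j] \<open>1 / 2 \<le> Max A\<close> by simp
    qed
  qed
qed

section \<open>Two forms of the Schwarz lemma\<close>

text \<open>The usual Schwarz lemma wants |h| < 1 strictly; it is applied to r h with r < 1, and
  then r tends to 1.\<close>

lemma Schwarz_Lemma_le:
  assumes "h holomorphic_on ball 0 1" and "h 0 = 0"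
    and "\<And>w. norm w < 1 \<Longrightarrow> norm (h w) \<le> 1" and "norm w < 1"
  shows "norm (h w) \<le> norm w"
proof (rule field_le_mult_one_interval)
  fix r :: real assume r: "0 < r" "r < 1"
  have "norm (of_real r * h w) \<le> norm w"
  proof (rule Schwarz_Lemma(1) [where f = "\<lambda>w. of_real r * h w"])
    fix z :: complex assume "norm z < 1"
    then have "norm (of_real r * h z) \<le> r * 1"
      using r assms(3) [of z] unfolding norm_mult by (intro mult_mono) auto
    then show "norm (of_real r * h z) < 1"
      using r by linarith
  qed (use assms in \<open>auto intro!: holomorphic_intros\<close>)
  then show "r * norm (h w) \<le> norm w"
    using r by (simp add: norm_mult)
qed

text \<open>On the circle of radius \<rho> the hypothesis gives |g| \<le> \<rho>^(-d); the maximum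
  principle carries this inside, and \<rho> tends to 1.\<close>

lemma norm_le_1_if_power_mult_le_1:
  assumes g: "g holomorphic_on ball 0 1"
    and le: "\<And>w. norm w < 1 \<Longrightarrow> norm (w ^ d * g w) \<le> 1" and w: "norm w < 1"
  shows "norm (g w) \<le> 1"
proof -
  have bound: "\<rho> ^ d * norm (g w) \<le> 1" if \<rho>: "norm w < \<rho>" "\<rho> < 1" for \<rho>
  proof -
    have "\<rho> > 0"
      using \<rho> norm_ge_zero [of w] by linarith
    have "norm (g w) \<le> 1 / \<rho> ^ d"
    proof (rule maximum_modulus_frontier [where f = g and S = "cball 0 \<rho>"])
      show "g holomorphic_on interior (cball 0 \<rho>)"
        using \<rho> by (intro holomorphic_on_subset [OF g]) auto
      show "continuous_on (closure (cball 0 \<rho>)) g"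
        using \<rho> by (intro holomorphic_on_imp_continuous_on holomorphic_on_subset [OF g]) auto
      fix v :: complex assume "v \<in> frontier (cball 0 \<rho>)"
      then have "norm v = \<rho>"
        using \<open>\<rho> > 0\<close> by (simp add: frontier_cball)
      then show "norm (g v) \<le> 1 / \<rho> ^ d"
        using le [of v] \<rho> \<open>\<rho> > 0\<close> by (simp add: norm_mult norm_power field_simps)
    qed (use \<rho> in auto)
    then show ?thesis
      using \<open>\<rho> > 0\<close> by (simp add: field_simps)
  qed
  have "((\<lambda>\<rho>. \<rho> ^ d * norm (g w)) \<longlongrightarrow> 1 ^ d * norm (g w)) (at_left 1)"
    by (intro tendsto_intros)
  moreover have "\<forall>\<^sub>F \<rho> in at_left 1. \<rho> ^ d * norm (g w) \<le> 1"
    using bound w by (intro eventually_at_leftI [of "norm w"]) auto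
  ultimately show ?thesis
    using tendsto_upperbound by fastforce
qed

section \<open>Automorphisms\<close>

lemma automorphism_coordinate_linear:
  assumes maps: "\<And>z. z \<in> ballB \<Longrightarrow> \<phi> z \<in> ballB"
    and aut: "Aplus_automorphism (comp_op \<phi>)"
    and zero: "\<And>z j. z \<in> ballB \<Longrightarrow> z j = 0 \<Longrightarrow> \<phi> z j = 0"
    and d: "d \<ge> 1" and u: "analytic_fun_B u"
    and \<phi>k: "\<And>z. z \<in> ballB \<Longrightarrow> \<phi> z k = z k ^ d * u z"
  shows "norm (u (\<lambda>j. 0)) = 1 \<and> (\<forall>z\<in>ballB. \<phi> z k = u (\<lambda>j. 0) * z k)"
proof -
  \<comment> \<open>The one-variable map that \<phi> induces on the k-th axis; the hypothesis
    \<open>zero\<close> is what keeps this axis invariant.\<close>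
  define p where "p = (\<lambda>t. \<phi> (on_axis k t) k)"
  have \<phi>_axis: "\<phi> (on_axis k t) = on_axis k (p t)" if "norm t < 1" for t
    using zero [OF on_axis_in_ballB [OF that]] by (auto simp: p_def on_axis_def fun_eq_iff)
  have p_lt: "norm (p t) < 1" if "norm t < 1" for t
    using maps [OF on_axis_in_ballB [OF that]] by (simp add: p_def ballB_def)
  have p_eq: "p t = t ^ d * u (on_axis k t)" if "norm t < 1" for t
    using \<phi>k [OF on_axis_in_ballB [OF that]] by (simp add: p_def)
  have axis_line: "on_axis k t = (\<lambda>j. 0 + t * on_axis k 1 j)" for t :: complex
    by (simp add: on_axis_def fun_eq_iff)
  have hol_u: "(\<lambda>t. u (on_axis k t)) holomorphic_on ball 0 1"
    using holomorphic_analytic_fun_B_on_line [OF u on_axis_in_c0 [of k 1] open_ball [of 0 1],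
        of "\<lambda>j. 0"]
    by (simp only: axis_line [symmetric]) (simp add: on_axis_in_ballB)
  have hol_p: "p holomorphic_on ball 0 1"
    by (rule holomorphic_transform [where f = "\<lambda>t. t ^ d * u (on_axis k t)"])
       (auto intro!: holomorphic_intros hol_u simp: p_eq)
  have p0: "p 0 = 0"
    using d by (simp add: p_eq)

  have onto: "\<exists>f\<in>Aplus. comp_op \<phi> f = g" if "g \<in> Aplus" for g
    using aut that unfolding Aplus_automorphism_def bij_betw_def by (metis imageE)
  \<comment> \<open>Surjectivity read on the axis: every absolutely summable power series in t
    factors through \<open>p\<close> via an element of the algebra.\<close>
  have axis_series: "\<exists>G\<in>Aplus. \<forall>t. norm t < 1 \<longrightarrow> G (on_axis k (p t)) = (\<Sum>n. b n * t ^ n)"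
    if b: "summable (\<lambda>n. norm (b n))" for b
  proof -
    obtain G where G: "G \<in> Aplus"
      "comp_op \<phi> G = (\<lambda>z. if z \<in> ballB then \<Sum>n. b n * z k ^ n else 0)"
      using onto [OF coordinate_series_in_Aplus [OF b]] by blast
    have "G (on_axis k (p t)) = (\<Sum>n. b n * t ^ n)" if "norm t < 1" for t
      using fun_cong [OF G(2), of "on_axis k t"] on_axis_in_ballB [OF that, of k] \<phi>_axis [OF that]
      by (simp add: comp_op_def)
    with G(1) show ?thesis
      by blast
  qed

  obtain f where f: "f \<in> Aplus"
    and f_series: "\<And>t. norm t < 1 \<Longrightarrow> f (on_axis k (p t)) = (\<Sum>n. (if n = 1 then 1 else 0) * t ^ n)"
  proof -
    have "summable (\<lambda>n. norm (if n = 1 then 1 else 0 :: complex))"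
      by (rule summable_finite [of "{1}"]) auto
    from axis_series [OF this] show ?thesis
      using that by blast
  qed
  define h where "h = (\<lambda>w. f (on_axis k w))"
  have hp: "h (p t) = t" if "norm t < 1" for t
    using f_series [OF that] suminf_finite [of "{1}" "\<lambda>n. (if n = 1 then 1 else 0) * t ^ n"]
    by (simp add: h_def)
  have hol_h: "h holomorphic_on ball 0 1"
    unfolding h_def by (rule holomorphic_Aplus_on_axis [OF f])
  have h0: "h 0 = 0"
    using hp [of 0] p0 by simp

  \<comment> \<open>Prepares the identity theorem: \<open>p\<close> is continuous with p(0) = 0, and
    h(p(t)) = t forces p(t) to be nonzero for t nonzero.\<close>
  have limpt: "0 islimpt p ` ball 0 1"
    unfolding islimpt_approachable
  proof (intro allI impI)
    fix e :: real assume "e > 0"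
    have "isCont p 0"
      by (rule continuous_on_interior [OF holomorphic_on_imp_continuous_on [OF hol_p]]) simp
    then obtain \<delta> where \<delta>: "\<delta> > 0" "\<And>t. norm t < \<delta> \<Longrightarrow> norm (p t) < e"
      using \<open>e > 0\<close> p0 unfolding continuous_at_eps_delta by (auto simp: dist_norm)
    define t :: complex where "t = of_real (min \<delta> 1 / 2)"
    have t: "norm t < \<delta>" "norm t < 1" "t \<noteq> 0"
      using \<delta>(1) by (auto simp: t_def)
    have "p t \<noteq> 0"
      using hp [OF t(2)] h0 t(3) by auto
    then show "\<exists>x\<in>p ` ball 0 1. x \<noteq> 0 \<and> dist x 0 < e"
      using \<delta>(2) [OF t(1)] t(2) by (intro bexI [of _ "p t"]) auto
  qed

  \<comment> \<open>A value \<open>\<lambda>\<close> of \<open>h\<close> outside the closed disc is impossible: \<open>z\<^sub>k - \<lambda>\<close> is invertible in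
    the algebra, hence so is its preimage under \<open>C\<^sub>\<phi>\<close>, whose restriction to the axis is \<open>h - \<lambda>\<close>.\<close>
  have h_le_1: "norm (h w) \<le> 1" if w: "norm w < 1" for w
  proof (rule ccontr)
    assume "\<not> norm (h w) \<le> 1"
    define l where "l = h w"
    have l: "norm l > 1"
      using \<open>\<not> norm (h w) \<le> 1\<close> by (simp add: l_def)
    then have l0: "l \<noteq> 0"
      by auto
    \<comment> \<open>Taylor coefficients of 1 / (t - l), absolutely summable because |l| >
      1.\<close>
    define b where "b = (\<lambda>n. - inverse l * inverse l ^ n)"
    have "summable (\<lambda>n. norm (b n))"
      unfolding b_def norm_mult norm_power using l
      by (intro summable_mult summable_geometric) (simp add: norm_inverse inverse_less_1_iff)
    then obtain G where G: "G \<in> Aplus"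
      and Gp: "\<And>t. norm t < 1 \<Longrightarrow> G (on_axis k (p t)) = (\<Sum>n. b n * t ^ n)"
      using axis_series by blast
    have inverse: "G (on_axis k (p t)) * (t - l) = 1" if t: "norm t < 1" for t
    proof -
      have "norm (t / l) < 1"
        using t l by (simp add: norm_divide divide_less_eq)
      then have "(\<lambda>n. - inverse l * (t / l) ^ n) sums (- inverse l * (1 / (1 - t / l)))"
        by (intro sums_mult geometric_sums)
      moreover have "b n * t ^ n = - inverse l * (t / l) ^ n" for n
        by (simp add: b_def power_divide field_simps)
      ultimately have "G (on_axis k (p t)) = - inverse l * (1 / (1 - t / l))"
        using Gp [OF t] by (simp add: sums_iff)
      moreover have "t - l \<noteq> 0"
        using t l by auto
      ultimately show ?thesis
        using l0 by (simp add: field_simps)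
    qed
    \<comment> \<open>The identity is known only on the image of \<open>p\<close>, and w need not
      lie there; analytic continuation extends it to the whole disc. Since h(w) = l, it then reads
      -1 = 0.\<close>
    have "G (on_axis k w) * (h w - l) - 1 = 0"
    proof (rule analytic_continuation [where S = "ball 0 1" and U = "p ` ball 0 1" and \<xi> = 0
          and f = "\<lambda>w. G (on_axis k w) * (h w - l) - 1"])
      show "(\<lambda>w. G (on_axis k w) * (h w - l) - 1) holomorphic_on ball 0 1"
        by (intro holomorphic_intros holomorphic_Aplus_on_axis G hol_h)
    qed (use limpt p_lt w inverse hp in auto)
    then show False
      by (simp add: l_def)
  qed
  have h_le: "norm (h w) \<le> norm w" if "norm w < 1" for w
    using Schwarz_Lemma_le [OF hol_h h0 h_le_1 that] .

  \<comment> \<open>With the other coordinates frozen, the k-th coordinate of \<phi> is w^d times a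
    holomorphic function of w and is bounded by 1, so the factor w^d can be divided out.\<close>
  have u_le_1: "norm (u z) \<le> 1" if z: "z \<in> ballB" for z
  proof -
    have line: "z(k := w) = (\<lambda>j. (z(k := 0)) j + w * on_axis k 1 j)" for w
      by (simp add: on_axis_def fun_eq_iff)
    have in_ball: "z(k := w) \<in> ballB" if "norm w < 1" for w
    proof -
      have "\<forall>\<^sub>F j in sequentially. z j = (z(k := w)) j"
        unfolding eventually_sequentially by (intro exI [of _ "Suc k"]) auto
      then show ?thesis
        using z that tendsto_cong [of z "z(k := w)" sequentially 0] by (simp add: ballB_def)
    qed
    have "norm (u (z(k := z k))) \<le> 1"
    proof (rule norm_le_1_if_power_mult_le_1 [where g = "\<lambda>w. u (z(k := w))" and d = d])
      show "(\<lambda>w. u (z(k := w))) holomorphic_on ball 0 1"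
        using holomorphic_analytic_fun_B_on_line [OF u on_axis_in_c0 [of k 1] open_ball [of 0 1],
            of "z(k := 0)"]
        by (simp only: line [symmetric]) (simp add: in_ball)
      fix w :: complex assume "norm w < 1"
      note zw = in_ball [OF this]
      have "norm (\<phi> (z(k := w)) k) < 1"
        using maps [OF zw] unfolding ballB_def by blast
      then show "norm (w ^ d * u (z(k := w))) \<le> 1"
        using \<phi>k [OF zw] by simp
    qed (use z in \<open>simp add: ballB_def\<close>)
    then show ?thesis
      by simp
  qed

  \<comment> \<open>Any point of the punctured disc would serve. At 1/2 the estimate reads 1/2 \<le>
    (1/2)^d |u|, which fails for d \<ge> 2 and forces |u| = 1 there when d = 1.\<close>
  have half: "norm (1 / 2 :: complex) < 1"
    by simp
  have "1 / 2 \<le> norm (p (1 / 2))"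
    using h_le [OF p_lt [OF half]] hp [OF half] by simp
  also have "\<dots> = (1 / 2) ^ d * norm (u (on_axis k (1 / 2)))"
    by (simp add: p_eq norm_mult norm_power norm_divide power_divide)
  finally have ge: "1 / 2 \<le> (1 / 2) ^ d * norm (u (on_axis k (1 / 2)))" .
  have "d = 1"
  proof (rule ccontr)
    assume "d \<noteq> 1"
    then have "(1 / 2 :: real) ^ d \<le> (1 / 2) ^ 2"
      using d by (intro power_decreasing) auto
    then have "(1 / 2) ^ d * norm (u (on_axis k (1 / 2))) \<le> (1 / 2) ^ 2 * 1"
      using u_le_1 [OF on_axis_in_ballB [OF half]] by (intro mult_mono) auto
    then show False
      using ge by (simp add: power2_eq_square)
  qed
  then have half_max: "norm (u (on_axis k (1 / 2))) \<ge> 1"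
    using ge by simp
  \<comment> \<open>The maximum of |u| at 1/2 is moved along the axis to the origin, which lies on a
    complex line with every other point of the ball.\<close>
  have "(\<lambda>t. u (on_axis k t)) constant_on ball 0 1"
  proof (rule maximum_modulus_principle [where U = "ball 0 1" and \<xi> = "1 / 2"])
    fix t :: complex assume "t \<in> ball 0 1"
    then show "norm (u (on_axis k t)) \<le> norm (u (on_axis k (1 / 2)))"
      using u_le_1 [OF on_axis_in_ballB, of t k] half_max by simp
  qed (use hol_u in auto)
  then have "u (on_axis k 0) = u (on_axis k (1 / 2))"
    using half unfolding constant_on_def by (metis dist_0_norm mem_ball norm_zero zero_less_one)
  then have u0: "norm (u (\<lambda>j. 0)) = 1"
    using half_max u_le_1 [OF on_axis_in_ballB [OF half, of k]] by (simp add: on_axis_def)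
  have "u z = u (\<lambda>j. 0)" if z: "z \<in> ballB" for z
  proof -
    obtain r where r: "0 < r" "r < 1" "\<And>j. norm (z j) \<le> r"
      using ballB_uniform_bound [OF z] by blast
    have line: "(\<lambda>j. 0 + t * z j) \<in> ballB" if "t \<in> ball 0 (1 / r)" for t
    proof -
      have "norm (t * z j) < 1" for j
      proof -
        have "norm (t * z j) \<le> norm t * r"
          using r(3) [of j] by (simp add: norm_mult mult_left_mono)
        also have "\<dots> < 1"
          using that r by (simp add: field_simps)
        finally show ?thesis .
      qed
      then show ?thesis
        using z tendsto_mult_right_zero [of z sequentially t] unfolding ballB_def by simp
    qed
    \<comment> \<open>Now |u| is maximal at the centre t = 0 of a disc that also contains t = 1, so
      u(z) = u(0).\<close>
    have "(\<lambda>t. u (\<lambda>j. 0 + t * z j)) constant_on ball 0 (1 / r)"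
    proof (rule maximum_modulus_principle [where U = "ball 0 (1 / r)" and \<xi> = 0])
      show "(\<lambda>t. u (\<lambda>j. 0 + t * z j)) holomorphic_on ball 0 (1 / r)"
        using z by (intro holomorphic_analytic_fun_B_on_line [OF u _ open_ball] line)
          (auto simp: c0_def ballB_def)
      fix t :: complex assume "t \<in> ball 0 (1 / r)"
      then show "norm (u (\<lambda>j. 0 + t * z j)) \<le> norm (u (\<lambda>j. 0 + 0 * z j))"
        using u_le_1 [OF line] u0 by simp
    qed (use r in auto)
    then obtain c where "\<And>t. t \<in> ball 0 (1 / r) \<Longrightarrow> u (\<lambda>j. 0 + t * z j) = c"
      unfolding constant_on_def by blast
    from this [of 0] this [of 1] show ?thesis
      using r by simp
  qed
  then show ?thesis
    using u0 \<phi>k \<open>d = 1\<close> by (simp add: mult.commute)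
qed

theorem theorem14:
  fixes \<phi> :: "seq \<Rightarrow> seq"
  assumes maps: "\<forall>z\<in>ballB. \<phi> z \<in> ballB"
    and anal: "analytic_map_B \<phi>"
    and inv: "\<forall>f\<in>Aplus. comp_op \<phi> f \<in> Aplus"
  shows
    "((\<exists>\<sigma> :: nat \<Rightarrow> nat. \<exists>\<epsilon> :: nat \<Rightarrow> complex. bij \<sigma> \<and> (\<forall>j. norm (\<epsilon> j) = 1) \<and>
         (\<forall>z\<in>ballB. \<phi> z = (\<lambda>j. \<epsilon> j * z (\<sigma> j))))
       \<longrightarrow> Aplus_automorphism (comp_op \<phi>) \<and>
           (\<forall>f\<in>Aplus. Aplus_norm (comp_op \<phi> f) = Aplus_norm f))
   \<and>
    ((Aplus_automorphism (comp_op \<phi>) \<and>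
      (\<forall>k. \<exists>d::nat. \<exists>u. d \<ge> 1 \<and> analytic_fun_B u \<and> u (\<lambda>j. 0) \<noteq> 0 \<and>
              (\<forall>z\<in>ballB. \<phi> z k = z k ^ d * u z)))
       \<longrightarrow> (\<exists>\<epsilon> :: nat \<Rightarrow> complex. (\<forall>j. norm (\<epsilon> j) = 1) \<and>
              (\<forall>z\<in>ballB. \<phi> z = (\<lambda>j. \<epsilon> j * z j))))"
proof (intro conjI impI)
  assume "\<exists>\<sigma> :: nat \<Rightarrow> nat. \<exists>\<epsilon> :: nat \<Rightarrow> complex. bij \<sigma> \<and> (\<forall>j. norm (\<epsilon> j) = 1) \<and>
         (\<forall>z\<in>ballB. \<phi> z = (\<lambda>j. \<epsilon> j * z (\<sigma> j)))"
  then obtain \<sigma> :: "nat \<Rightarrow> nat" and \<epsilon> :: "nat \<Rightarrow> complex" where \<sigma>: "bij \<sigma>"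
    and \<epsilon>: "\<And>j. norm (\<epsilon> j) = 1" and \<phi>: "\<And>z. z \<in> ballB \<Longrightarrow> \<phi> z = (\<lambda>j. \<epsilon> j * z (\<sigma> j))"
    by blast
  show "Aplus_automorphism (comp_op \<phi>)"
    using \<sigma> \<epsilon> \<phi> by (rule weighted_perm_automorphism)
  show "\<forall>f\<in>Aplus. Aplus_norm (comp_op \<phi> f) = Aplus_norm f"
    using Aplus_rep_weighted_perm(2) [OF \<sigma> \<epsilon> \<phi>] unfolding Aplus_def by blast
next
  assume hyp: "Aplus_automorphism (comp_op \<phi>) \<and>
      (\<forall>k. \<exists>d::nat. \<exists>u. d \<ge> 1 \<and> analytic_fun_B u \<and> u (\<lambda>j. 0) \<noteq> 0 \<and>
              (\<forall>z\<in>ballB. \<phi> z k = z k ^ d * u z))"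
  then obtain d :: "nat \<Rightarrow> nat" and u where d: "\<And>k. d k \<ge> 1" and u: "\<And>k. analytic_fun_B (u k)"
    and \<phi>k: "\<And>k z. z \<in> ballB \<Longrightarrow> \<phi> z k = z k ^ d k * u k z"
    by metis
  have zero: "\<phi> z j = 0" if "z \<in> ballB" "z j = 0" for z j
    using \<phi>k [OF that(1), of j] that(2) d [of j] by simp
  have "norm (u k (\<lambda>j. 0)) = 1 \<and> (\<forall>z\<in>ballB. \<phi> z k = u k (\<lambda>j. 0) * z k)" for k
    using maps hyp by (intro automorphism_coordinate_linear [OF _ _ zero d u \<phi>k]) auto
  then show "\<exists>\<epsilon> :: nat \<Rightarrow> complex. (\<forall>j. norm (\<epsilon> j) = 1) \<and>
              (\<forall>z\<in>ballB. \<phi> z = (\<lambda>j. \<epsilon> j * z j))"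
    \<comment> \<open>The weights are the values u_k(0).\<close>
    by (intro exI [of _ "\<lambda>k. u k (\<lambda>j. 0)"]) (auto simp: fun_eq_iff)
qed

end
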